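(* Given the Gaussian regression model $y_i=\mu(\boldsymbol x_i;\boldsymbol\beta)+\varepsilon_i$, $\varepsilon_i\sim N(0;\sigma^2h(\boldsymbol x_i;\boldsymbol\gamma))$, $i=1,\dots,n$, the noncentrality parameter of the asymptotic distribution of a likelihood-based statistic for testing $H_0:\boldsymbol\gamma=\boldsymbol\gamma_0$ against $H_1:\boldsymbol\gamma=\boldsymbol\gamma_0+\boldsymbol\lambda/\sqrt n$, $\boldsymbol\lambda\neq\boldsymbol 0$, is $$\zeta(\xi;\boldsymbol\lambda;\boldsymbol\gamma_0)=\frac12\,\boldsymbol\lambda^T\left(\sum_{i=1}^k\nabla h(\boldsymbol x_i;\boldsymbol\gamma_0)\nabla h(\boldsymbol x_i;\boldsymbol\gamma_0)^T\xi(\boldsymbol x_i)-\sum_{i=1}^k\nabla h(\boldsymbol x_i;\boldsymbol\gamma_0)\xi(\boldsymbol x_i)\,\sum_{i=1}^k\nabla h(\boldsymbol x_i;\boldsymbol\gamma_0)^T\xi(\boldsymbol x_i)\right)\boldsymbol\lambda .$$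
   Context: Setting. In the model, $\boldsymbol\beta\in\mathbb{R}^m$, $\sigma^2$ is an unknown constant, $\boldsymbol\gamma\in\mathbb{R}^s$, $\boldsymbol\lambda\in\mathbb{R}^s$, and $h:\mathbb{R}^p\times\mathbb{R}^s\to\mathbb{R}_+$ is a continuous positive function; $\boldsymbol\gamma_0$ is a value such that $h(\boldsymbol x;\boldsymbol\gamma_0)=1$ (the homoscedastic model). Experimental points lie in a compact set $\mathcal X\subseteq\mathbb{R}^p$. A design $\xi$ is a discrete probability measure on $\mathcal X$ with support points $\boldsymbol x_1,\dots,\boldsymbol x_k$ and weights $\xi(\boldsymbol x_i)$. $\nabla\mu$ is the gradient in $\boldsymbol\beta$, and $\nabla h$ the gradient in $\boldsymbol\gamma$. The Fisher information matrix of the design for $(\boldsymbol\beta,\sigma^2,\boldsymbol\gamma)$ is $\mathcal I=\begin{bmatrix}\mathcal I_{11}&\mathcal I_{12}\\ \mathcal I_{12}^T&\mathcal I_{22}\end{bmatrix}$ with $$\mathcal I_{11}=\begin{bmatrix}\boldsymbol M&\boldsymbol 0\\ \boldsymbol 0^T&\frac1{2\sigma^4}\end{bmatrix},\quad \boldsymbol M=\sum_{i=1}^k\frac{\nabla\mu(\boldsymbol x_i;\boldsymbol\beta)\nabla\mu(\boldsymbol x_i;\boldsymbol\beta)^T}{\sigma^2h(\boldsymbol x_i;\boldsymbol\gamma)}\xi(\boldsymbol x_i),$$ $$\mathcal I_{12}=\begin{bmatrix}\boldsymbol 0\\ \sum_{i=1}^k\frac{\nabla h(\boldsymbol x_i;\boldsymbol\gamma)^T}{2\sigma^2h(\boldsymbol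 x_i;\boldsymbol\gamma)}\xi(\boldsymbol x_i)\end{bmatrix},\quad \mathcal I_{22}=\sum_{i=1}^k\frac{\nabla h(\boldsymbol x_i;\boldsymbol\gamma)\nabla h(\boldsymbol x_i;\boldsymbol\gamma)^T}{2h(\boldsymbol x_i;\boldsymbol\gamma)^2}\xi(\boldsymbol x_i),$$ where $\boldsymbol 0$ in $\mathcal I_{12}$ is an $m\times s$ zero block, and $\mathcal I_{22.1}(\xi;\boldsymbol\gamma)=\mathcal I_{22}-\mathcal I_{12}^T\mathcal I_{11}^{-1}\mathcal I_{12}$ is the Schur complement. It is taken as well known that, under $H_1$, the likelihood-based statistics (log-likelihood ratio, Wald and score) are asymptotically distributed as a chi-squared random variable with $s$ degrees of freedom and noncentrality parameter $\zeta(\xi;\boldsymbol\lambda;\boldsymbol\gamma_0)=\boldsymbol\lambda^T\mathcal I_{22.1}(\xi;\boldsymbol\gamma_0)\boldsymbol\lambda$; the claim gives the analytic expression of this quantity. *)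

theory Defs
  imports "HOL-Probability.Probability"
begin

definition gradient :: "(real^'n \<Rightarrow> real) \<Rightarrow> real^'n \<Rightarrow> real^'n" where
  "gradient f x = (THE D. GDERIV f x :> D)"

text \<open>
  The matrix \<open>u v\<^sup>T\<close>. The library's \<open>columnvector\<close> and \<open>rowvector\<close> are polymorphic in the
  dimension along which the vector is repeated, so that dimension has to be fixed to \<open>1\<close>.
\<close>

definition outer :: "real^'a \<Rightarrow> real^'b \<Rightarrow> real^'b^'a" where
  "outer u v = (columnvector u :: real^1^'a) ** (rowvector v :: real^'b^1)"

definition vblocks :: "real^'a^'c \<Rightarrow> real^'a^'d \<Rightarrow> real^'a^('c + 'd)" where
  "vblocks A B = (\<chi> i. case i of Inl k \<Rightarrow> A $ k | Inr k \<Rightarrow> B $ k)"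

definition hblocks :: "real^'a^'c \<Rightarrow> real^'b^'c \<Rightarrow> real^('a + 'b)^'c" where
  "hblocks A B = (\<chi> i j. case j of Inl k \<Rightarrow> A $ i $ k | Inr k \<Rightarrow> B $ i $ k)"

definition four_blocks ::
    "real^'a^'c \<Rightarrow> real^'b^'c \<Rightarrow> real^'a^'d \<Rightarrow> real^'b^'d \<Rightarrow> real^('a + 'b)^('c + 'd)" where
  "four_blocks A B C D = vblocks (hblocks A B) (hblocks C D)"

text \<open>
  The Gaussian model with mean \<open>\<mu> x \<beta>\<close> and variance \<open>\<sigma>\<^sup>2 h x \<gamma>\<close> at the point \<open>x\<close>. A design is a
  probability mass function \<open>\<xi>\<close> with finite support: its support points are the elements of
  \<open>set_pmf \<xi>\<close>, with weights \<open>pmf \<xi> x\<close>.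

  The parameters are ordered as \<open>(\<beta>, \<sigma>\<^sup>2, \<gamma>)\<close>. Accordingly, the information matrix is indexed
  by \<open>('m + 1) + 's\<close>, where the type \<open>1\<close> stands for the scalar parameter \<open>\<sigma>\<^sup>2\<close>. The
  information refers to \<open>\<sigma>\<^sup>2\<close> and not to \<open>\<sigma>\<close>.
\<close>

definition info_M ::
    "(real^'p \<Rightarrow> real^'m \<Rightarrow> real) \<Rightarrow> (real^'p \<Rightarrow> real^'s \<Rightarrow> real) \<Rightarrow> (real^'p) pmf
      \<Rightarrow> real^'m \<Rightarrow> real \<Rightarrow> real^'s \<Rightarrow> real^'m^'m" where
  "info_M \<mu> h \<xi> \<beta> \<sigma> \<gamma> =
    (\<Sum>x\<in>set_pmf \<xi>. (pmf \<xi> x / (\<sigma>\<^sup>2 * h x \<gamma>)) *\<^sub>R outer (gradient (\<mu> x) \<beta>) (gradient (\<mu> x) \<beta>))"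

definition info_11 ::
    "(real^'p \<Rightarrow> real^'m \<Rightarrow> real) \<Rightarrow> (real^'p \<Rightarrow> real^'s \<Rightarrow> real) \<Rightarrow> (real^'p) pmf
      \<Rightarrow> real^'m \<Rightarrow> real \<Rightarrow> real^'s \<Rightarrow> real^('m + 1)^('m + 1)" where
  "info_11 \<mu> h \<xi> \<beta> \<sigma> \<gamma> = four_blocks (info_M \<mu> h \<xi> \<beta> \<sigma> \<gamma>) 0 0 (mat (1 / (2 * \<sigma> ^ 4)))"

definition info_12 ::
    "(real^'p \<Rightarrow> real^'s \<Rightarrow> real) \<Rightarrow> (real^'p) pmf \<Rightarrow> real \<Rightarrow> real^'s \<Rightarrow> real^'s^('m::finite + 1)" where
  "info_12 h \<xi> \<sigma> \<gamma> =
    vblocks 0 (\<Sum>x\<in>set_pmf \<xi>. (pmf \<xi> x / (2 * \<sigma>\<^sup>2 * h x \<gamma>)) *\<^sub>R rowvector (gradient (h x) \<gamma>))"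

definition info_22 ::
    "(real^'p \<Rightarrow> real^'s \<Rightarrow> real) \<Rightarrow> (real^'p) pmf \<Rightarrow> real^'s \<Rightarrow> real^'s^'s" where
  "info_22 h \<xi> \<gamma> =
    (\<Sum>x\<in>set_pmf \<xi>. (pmf \<xi> x / (2 * (h x \<gamma>)\<^sup>2)) *\<^sub>R outer (gradient (h x) \<gamma>) (gradient (h x) \<gamma>))"

definition fisher_info ::
    "(real^'p \<Rightarrow> real^'m \<Rightarrow> real) \<Rightarrow> (real^'p \<Rightarrow> real^'s \<Rightarrow> real) \<Rightarrow> (real^'p) pmf
      \<Rightarrow> real^'m \<Rightarrow> real \<Rightarrow> real^'s \<Rightarrow> real^(('m + 1) + 's)^(('m + 1) + 's)" where
  "fisher_info \<mu> h \<xi> \<beta> \<sigma> \<gamma> =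
    four_blocks (info_11 \<mu> h \<xi> \<beta> \<sigma> \<gamma>) (info_12 h \<xi> \<sigma> \<gamma>)
      (transpose (info_12 h \<xi> \<sigma> \<gamma>)) (info_22 h \<xi> \<gamma>)"

definition schur_complement :: "real^('a::finite + 'b::finite)^('a + 'b) \<Rightarrow> real^'b^'b" where
  "schur_complement A =
    (let A11 = (\<chi> i j. A $ Inl i $ Inl j) :: real^'a^'a;
         A12 = (\<chi> i j. A $ Inl i $ Inr j) :: real^'b^'a;
         A21 = (\<chi> i j. A $ Inr i $ Inl j) :: real^'a^'b;
         A22 = (\<chi> i j. A $ Inr i $ Inr j) :: real^'b^'b
     in A22 - A21 ** matrix_inv A11 ** A12)"

text \<open>\<open>\<I>\<^sub>2\<^sub>2\<^sub>.\<^sub>1\<close>; it is meaningful only where \<open>info_11\<close> is invertible.\<close>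

definition info_22_1 ::
    "(real^'p \<Rightarrow> real^'m \<Rightarrow> real) \<Rightarrow> (real^'p \<Rightarrow> real^'s \<Rightarrow> real) \<Rightarrow> (real^'p) pmf
      \<Rightarrow> real^'m \<Rightarrow> real \<Rightarrow> real^'s \<Rightarrow> real^'s^'s" where
  "info_22_1 \<mu> h \<xi> \<beta> \<sigma> \<gamma> = schur_complement (fisher_info \<mu> h \<xi> \<beta> \<sigma> \<gamma>)"

lemma info_22_1_blocks:
  "info_22_1 \<mu> h \<xi> \<beta> \<sigma> \<gamma> = info_22 h \<xi> \<gamma>
    - transpose (info_12 h \<xi> \<sigma> \<gamma>) ** matrix_inv (info_11 \<mu> h \<xi> \<beta> \<sigma> \<gamma>) ** info_12 h \<xi> \<sigma> \<gamma>"
  by (simp add: info_22_1_def schur_complement_def fisher_info_def four_blocks_def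
      vblocks_def hblocks_def)

text \<open>
  Noncentrality parameter of the limiting \<open>\<chi>\<^sup>2\<close> distribution (with \<open>CARD('s)\<close> degrees of freedom)
  of the likelihood ratio, Wald and score statistics for \<open>\<gamma> = \<gamma>\<^sub>0\<close> under the local
  alternatives \<open>\<gamma> = \<gamma>\<^sub>0 + \<lambda> / sqrt n\<close>.
\<close>

definition noncentrality ::
    "(real^'p \<Rightarrow> real^'m \<Rightarrow> real) \<Rightarrow> (real^'p \<Rightarrow> real^'s \<Rightarrow> real) \<Rightarrow> (real^'p) pmf
      \<Rightarrow> real^'m \<Rightarrow> real \<Rightarrow> real^'s \<Rightarrow> real^'s \<Rightarrow> real" where
  "noncentrality \<mu> h \<xi> \<beta> \<sigma> l \<gamma>\<^sub>0 = l \<bullet> (info_22_1 \<mu> h \<xi> \<beta> \<sigma> \<gamma>\<^sub>0 *v l)"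

end

theory Submission
  imports Defs
begin

text \<open>
  The Schur complement involves \<open>\<I>\<^sub>1\<^sub>1\<close> only through the solution \<open>X\<close> of \<open>\<I>\<^sub>1\<^sub>1 X = \<I>\<^sub>1\<^sub>2\<close>.
  At \<open>\<gamma>\<^sub>0\<close> the \<open>\<beta>\<close>-block of \<open>\<I>\<^sub>1\<^sub>2\<close> vanishes and its last row is \<open>w\<^sup>T / (2 \<sigma>\<^sup>2)\<close>, where \<open>w\<close> is the
  mean gradient of \<open>h\<close>, so \<open>X\<close> has last row \<open>\<sigma>\<^sup>2 w\<^sup>T\<close> and \<open>\<I>\<^sub>1\<^sub>2\<^sup>T X = w w\<^sup>T / 2\<close>; in particular
  \<open>M\<close> never needs to be inverted.
\<close>

lemma sum_UNIV_Plus: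
  fixes f :: "'a::finite + 'b::finite \<Rightarrow> 'c::comm_monoid_add"
  shows "(\<Sum>i\<in>UNIV. f i) = (\<Sum>i\<in>UNIV. f (Inl i)) + (\<Sum>i\<in>UNIV. f (Inr i))"
  unfolding UNIV_Plus_UNIV[symmetric] by (subst sum.Plus) (simp_all add: comp_def)

text \<open>The upper block of the product is \<open>A ** 0 + 0 ** Y\<close>, so \<open>A\<close>
  drops out whatever it is; here \<open>A\<close> will be \<open>info_M\<close>.\<close>

lemma four_blocks_diag_mul_vblocks:
  "four_blocks A 0 0 D ** vblocks 0 Y = vblocks 0 (D ** Y)"
  by (auto simp: vec_eq_iff four_blocks_def vblocks_def hblocks_def matrix_matrix_mult_def
      sum_UNIV_Plus split: sum.split)

lemma transpose_vblocks_mul_vblocks: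
  "transpose (vblocks A B) ** vblocks C D = transpose A ** C + transpose B ** D"
  by (simp add: vec_eq_iff vblocks_def matrix_matrix_mult_def transpose_def sum_UNIV_Plus)

lemma mat_mul_eq_scaleR: "mat c ** A = c *\<^sub>R (A :: real^'b^'a::finite)"
  by (simp add: vec_eq_iff mat_def matrix_matrix_mult_def if_distrib[where f = "\<lambda>x. x * _"] cong: if_cong)

lemma rowvector_scaleR: "rowvector (c *\<^sub>R v) = (c *\<^sub>R rowvector v :: real^'n^1)"
  by (simp add: vec_eq_iff rowvector_def)

lemma rowvector_sum: "rowvector (\<Sum>x\<in>S. f x) = (\<Sum>x\<in>S. rowvector (f x) :: real^'n^1)"
  by (simp add: vec_eq_iff rowvector_def)

text \<open>The inner index has type \<open>1\<close>, so each entry of the product is a single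
  term. This turns the scalar \<sigma>-block into a rank-one correction.\<close>

lemma transpose_rowvector_mul:
  "transpose (c *\<^sub>R rowvector u) ** (d *\<^sub>R rowvector v :: real^'b^1) = (c * d) *\<^sub>R outer u v"
  by (simp add: vec_eq_iff outer_def transpose_def rowvector_def columnvector_def
      matrix_matrix_mult_def)

lemma matrix_inv_mul_eqI:
  fixes A :: "real^'n^'n" and X B :: "real^'k^'n"
  assumes "invertible A" "A ** X = B"
  shows "matrix_inv A ** B = X"
proof -
  have "matrix_inv A ** A = mat 1"
    \<comment> \<open>\<open>matrix_inv\<close> is a choice among two-sided inverses; invertibility
      provides one, and only its left half is kept.\<close>
    using assms(1) unfolding invertible_def matrix_inv_def by (rule someI2_ex) simp
  then show ?thesis
    unfolding assms(2)[symmetric] by (simp add: matrix_mul_assoc)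
qed

theorem theorem2:
  fixes \<mu> :: "real^'p \<Rightarrow> real^'m \<Rightarrow> real"
    and h :: "real^'p \<Rightarrow> real^'s \<Rightarrow> real"
    and X :: "(real^'p) set"
    and \<xi> :: "(real^'p) pmf"
    and \<beta> :: "real^'m" and \<sigma> :: real and \<gamma>\<^sub>0 l :: "real^'s"
  assumes \<sigma>: "\<sigma> > 0"
    and h_cont: "continuous_on UNIV (\<lambda>(x, \<gamma>). h x \<gamma>)"
    and h_pos: "\<And>x \<gamma>. h x \<gamma> > 0"
    and homoscedastic: "\<And>x. x \<in> X \<Longrightarrow> h x \<gamma>\<^sub>0 = 1"
    and \<mu>_diff: "\<And>x. x \<in> X \<Longrightarrow> \<mu> x differentiable (at \<beta>)"
    and h_diff: "\<And>x. x \<in> X \<Longrightarrow> h x differentiable (at \<gamma>\<^sub>0)"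
    and X: "compact X"
    and design: "finite (set_pmf \<xi>)" "set_pmf \<xi> \<subseteq> X"
    and inv_11: "invertible (info_11 \<mu> h \<xi> \<beta> \<sigma> \<gamma>\<^sub>0)"
    and l: "l \<noteq> 0"
  shows "noncentrality \<mu> h \<xi> \<beta> \<sigma> l \<gamma>\<^sub>0 =
    1 / 2 * (l \<bullet> (((\<Sum>x\<in>set_pmf \<xi>. pmf \<xi> x *\<^sub>R outer (gradient (h x) \<gamma>\<^sub>0) (gradient (h x) \<gamma>\<^sub>0))
      - outer (\<Sum>x\<in>set_pmf \<xi>. pmf \<xi> x *\<^sub>R gradient (h x) \<gamma>\<^sub>0)
          (\<Sum>x\<in>set_pmf \<xi>. pmf \<xi> x *\<^sub>R gradient (h x) \<gamma>\<^sub>0)) *v l))"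
proof -
  let ?g = "\<lambda>x. gradient (h x) \<gamma>\<^sub>0"
  define w where "w = (\<Sum>x\<in>set_pmf \<xi>. pmf \<xi> x *\<^sub>R ?g x)"
  define r where "r = (rowvector w :: real^'s^1)"
  have h1: "h x \<gamma>\<^sub>0 = 1" if "x \<in> set_pmf \<xi>" for x
    using homoscedastic design(2) that by blast
  \<comment> \<open>The annotated zero block fixes the dimension \<open>'m\<close>, which the
    arguments of \<open>info_12\<close> leave open.\<close>
  have i12: "info_12 h \<xi> \<sigma> \<gamma>\<^sub>0 = vblocks (0 :: real^'s^'m) ((1 / (2 * \<sigma>\<^sup>2)) *\<^sub>R r)"
    by (simp add: info_12_def r_def w_def rowvector_sum rowvector_scaleR scaleR_sum_right h1)
  have i22: "info_22 h \<xi> \<gamma>\<^sub>0 = (1 / 2) *\<^sub>R (\<Sum>x\<in>set_pmf \<xi>. pmf \<xi> x *\<^sub>R outer (?g x) (?g x))"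
    by (simp add: info_22_def scaleR_sum_right h1)
  \<comment> \<open>The factor \<open>\<sigma>\<^sup>2\<close> solves
    \<open>c / (2 * \<sigma> ^ 4) = 1 / (2 * \<sigma>\<^sup>2)\<close> for \<open>c\<close>.\<close>
  have "info_11 \<mu> h \<xi> \<beta> \<sigma> \<gamma>\<^sub>0 ** vblocks 0 (\<sigma>\<^sup>2 *\<^sub>R r) = info_12 h \<xi> \<sigma> \<gamma>\<^sub>0"
    using \<sigma> by (simp add: info_11_def four_blocks_diag_mul_vblocks mat_mul_eq_scaleR i12
        power4_eq_xxxx power2_eq_square)
  then have "matrix_inv (info_11 \<mu> h \<xi> \<beta> \<sigma> \<gamma>\<^sub>0) ** info_12 h \<xi> \<sigma> \<gamma>\<^sub>0 = vblocks 0 (\<sigma>\<^sup>2 *\<^sub>R r)"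
    by (rule matrix_inv_mul_eqI[OF inv_11])
  then have "transpose (info_12 h \<xi> \<sigma> \<gamma>\<^sub>0) ** matrix_inv (info_11 \<mu> h \<xi> \<beta> \<sigma> \<gamma>\<^sub>0)
      ** info_12 h \<xi> \<sigma> \<gamma>\<^sub>0 =
      transpose (vblocks (0 :: real^'s^'m) ((1 / (2 * \<sigma>\<^sup>2)) *\<^sub>R r)) ** vblocks 0 (\<sigma>\<^sup>2 *\<^sub>R r)"
    by (simp add: matrix_mul_assoc[symmetric] i12)
  \<comment> \<open>The scalars \<open>1 / (2 * \<sigma>\<^sup>2)\<close> and
    \<open>\<sigma>\<^sup>2\<close> multiply to \<open>1 / 2\<close>, so the result is free of
    \<sigma>.\<close>
  also have "\<dots> = (1 / 2) *\<^sub>R outer w w"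
    using \<sigma> by (simp add: transpose_vblocks_mul_vblocks r_def transpose_rowvector_mul)
  finally have "info_22_1 \<mu> h \<xi> \<beta> \<sigma> \<gamma>\<^sub>0 =
      (1 / 2) *\<^sub>R ((\<Sum>x\<in>set_pmf \<xi>. pmf \<xi> x *\<^sub>R outer (?g x) (?g x)) - outer w w)"
    by (simp add: info_22_1_blocks i22 scaleR_diff_right)
  then show ?thesis
    by (simp add: noncentrality_def w_def scaleR_matrix_vector_assoc[symmetric])
qed

end
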